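(* Let $d\ge 1$. There is a constant $c_d>0$ depending only on $d$ such that the following holds. Given an open convex body $K\subset\mathbb{R}^d$ and $\varepsilon\in(0,1/3)$, there is a data structure that answers the $\varepsilon$-approximate depth query for $K$ (for every query point $q\in\mathbb{R}^d$), with storage space at most $c_d\,\varepsilon^{-(5d+1)/2}$ and query time at most $c_d\,\dfrac{1}{\varepsilon^2}\left(\ln\dfrac1\varepsilon\right)^2$.
   Context: An open convex body is a nonempty, bounded, open convex subset of $\mathbb{R}^d$. $|S|$ denotes Lebesgue volume. The halfspace depth of $q\in\mathbb{R}^d$ with respect to $K$ is $$D_K(q)=\inf\left\{\frac{|\{z\in K:\langle v,z-q\rangle\ge 0\}|}{|K|}: v\in\mathbb{R}^d,\ \|v\|=1\right\}.$$ The $\varepsilon$-approximate depth query for $K$ is the following problem: given a query point $q\in\mathbb{R}^d$, return a value $\mathfrak{D}(q)$ such that $\mathfrak{D}(q)=\varepsilon$ if $D_K(q)\le\varepsilon$, and $(1-\varepsilon)D_K(q)\le\mathfrak{D}(q)\le(1-\varepsilon)^{-1}D_K(q)$ otherwise. The data structure is allowed to depend on $K$ and $\varepsilon$ (but not on $q$). The statement concerns only the existence of the data structure; its construction (preprocessing) time is not counted. Storage space is the number of units (real numbers, integers, pointers) stored, and query time is the number of elementary operations (arithmetic operations and comparisons on reals, memory accesses) performed to answer a query. The dimension $d$ is treated as fixed, so that storing or manipulating a point or an ellipsoid in $\mathbb{R}^d$ costs a constant depending only on $d$. *)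

theory Defs
  imports "HOL-Analysis.Analysis"
begin

definition open_convex_body :: "(real ^ 'n) set \<Rightarrow> bool" where
  "open_convex_body K \<longleftrightarrow> K \<noteq> {} \<and> bounded K \<and> open K \<and> convex K"

definition halfspace_depth :: "(real ^ 'n) set \<Rightarrow> real ^ 'n \<Rightarrow> real" where
  "halfspace_depth K q =
     Inf {measure lebesgue {z \<in> K. v \<bullet> (z - q) \<ge> 0} / measure lebesgue K | v. norm v = 1}"

definition valid_depth_answer ::
  "(real ^ 'n) set \<Rightarrow> real \<Rightarrow> real ^ 'n \<Rightarrow> real \<Rightarrow> bool" where
  "valid_depth_answer K \<epsilon> q out \<longleftrightarrow>
     (if halfspace_depth K q \<le> \<epsilon> then out = \<epsilon>
      else (1 - \<epsilon>) * halfspace_depth K q \<le> out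
         \<and> out \<le> inverse (1 - \<epsilon>) * halfspace_depth K q)"

text \<open>
  Query algorithms are programs for a real random access machine.  The memory is an array of
  cells, each holding one real number; integers and pointers are stored as reals.  Every executed
  instruction counts as one unit of time and performs at most one arithmetic operation or
  comparison and a bounded number of memory accesses.  There is no rounding operation: indirect
  addressing through a cell that does not hold a natural number fails, as does division by zero,
  and a failed run returns nothing.  Literal constants in programs are integers, so all other
  numerical data has to come from the memory or from the query point.
\<close>

datatype 'n instr =
    Const nat int
  | Input nat 'n         (* read one coordinate of the query point *)
  | Add nat nat nat
  | Sub nat nat nat
  | Mul nat nat nat
  | Div nat nat nat
  | Load nat nat         (* the second operand is the cell holding the address *)
  | Store nat nat        (* the first operand is the cell holding the address *)
  | JumpLe nat nat nat
  | Return nat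

type_synonym memory = "nat \<Rightarrow> real"

fun exec_instr ::
  "real ^ 'n \<Rightarrow> 'n instr \<Rightarrow> nat \<times> memory \<Rightarrow> (nat \<times> memory) option" where
  "exec_instr q (Const a k) (pc, M) = Some (Suc pc, M(a := of_int k))"
| "exec_instr q (Input a i) (pc, M) = Some (Suc pc, M(a := q $ i))"
| "exec_instr q (Add a b c) (pc, M) = Some (Suc pc, M(a := M b + M c))"
| "exec_instr q (Sub a b c) (pc, M) = Some (Suc pc, M(a := M b - M c))"
| "exec_instr q (Mul a b c) (pc, M) = Some (Suc pc, M(a := M b * M c))"
| "exec_instr q (Div a b c) (pc, M) =
     (if M c = 0 then None else Some (Suc pc, M(a := M b / M c)))"
| "exec_instr q (Load a b) (pc, M) =
     (if M b \<in> \<nat> then Some (Suc pc, M(a := M (nat \<lfloor>M b\<rfloor>))) else None)"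
| "exec_instr q (Store a b) (pc, M) =
     (if M a \<in> \<nat> then Some (Suc pc, M(nat \<lfloor>M a\<rfloor> := M b)) else None)"
| "exec_instr q (JumpLe a b l) (pc, M) = Some (if M a \<le> M b then l else Suc pc, M)"
| "exec_instr q (Return a) (pc, M) = None"

text \<open>
  \<open>runs P q pc M t v\<close>: started at position \<open>pc\<close> with memory \<open>M\<close> on query point \<open>q\<close>, the program
  \<open>P\<close> executes exactly \<open>t\<close> instructions and returns the value \<open>v\<close>.
\<close>

inductive runs ::
  "'n instr list \<Rightarrow> real ^ 'n \<Rightarrow> nat \<Rightarrow> memory \<Rightarrow> nat \<Rightarrow> real \<Rightarrow> bool"
  for P :: "'n instr list" and q :: "real ^ 'n" where
  return: "pc < length P \<Longrightarrow> P ! pc = Return a \<Longrightarrow> runs P q pc M 1 (M a)"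
| step: "pc < length P \<Longrightarrow> exec_instr q (P ! pc) (pc, M) = Some (pc', M') \<Longrightarrow>
     runs P q pc' M' t v \<Longrightarrow> runs P q pc M (Suc t) v"

text \<open>
  The stored data is a list of cells, one unit of storage each.  It occupies an initial segment
  of the memory, and the rest is zero-initialised working memory.  Each query starts from this
  same memory.
\<close>

definition initial_memory :: "real list \<Rightarrow> memory" where
  "initial_memory cells = (\<lambda>a. if a < length cells then cells ! a else 0)"

definition storage_space :: "real list \<Rightarrow> nat" where
  "storage_space cells = length cells"

definition answers_depth_queries_within ::
  "'n instr list \<Rightarrow> real list \<Rightarrow> (real ^ 'n) set \<Rightarrow> real \<Rightarrow> real \<Rightarrow> bool" where
  "answers_depth_queries_within P cells K \<epsilon> T \<longleftrightarrow>
     (\<forall>q. \<exists>t out. runs P q 0 (initial_memory cells) t out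
        \<and> real t \<le> T \<and> valid_depth_answer K \<epsilon> q out)"

end

theory Submission
  imports Defs
begin

text \<open>A uniform grid with spacing of order \<open>\<epsilon>\<^sup>2\<close> in coordinates adapted to \<open>K\<close> suffices.  Contracting
  \<open>K\<close> by \<open>1 - s\<close> towards one of its points maps halfspaces to parallel halfspaces, so that moving \<open>q\<close>
  by \<open>s\<close> times the way to a point of \<open>K\<close> lowers the depth at most by the factor \<open>(1 - s)^d\<close>.  A
  point of depth more than \<open>\<epsilon>\<close> has distance at least of order \<open>\<epsilon>\<close> from the boundary, since thin caps
  have small volume.  Taking \<open>s = \<epsilon> / d\<close>, the depth changes at most by the factor \<open>1 - \<epsilon>\<close> within a
  grid cell.  The table has of order \<open>\<epsilon> powr (- 2 * d)\<close> entries, and as the time bound is of order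
  \<open>1 / \<epsilon>\<^sup>2\<close> or more, the cell of \<open>q\<close> can be found by a linear scan in each coordinate.\<close>

section \<open>Caps and halfspace depth under contraction\<close>

lemma convex_bounded_cap:
  fixes K :: "'a::euclidean_space set"
  assumes "convex K" "bounded K"
  shows "convex {z \<in> K. v \<bullet> (z - q) \<ge> 0}" "bounded {z \<in> K. v \<bullet> (z - q) \<ge> 0}"
proof -
  have "{z \<in> K. v \<bullet> (z - q) \<ge> 0} = K \<inter> {z. v \<bullet> z \<ge> v \<bullet> q}"
    by (auto simp: inner_diff_right)
  then show "convex {z \<in> K. v \<bullet> (z - q) \<ge> 0}" "bounded {z \<in> K. v \<bullet> (z - q) \<ge> 0}"
    using assms by (simp_all add: convex_Int convex_halfspace_ge bounded_Int)
qed

lemma lmeasurable_convex_affinity: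
  fixes S :: "'a::euclidean_space set"
  assumes "convex S" "bounded S"
  shows "(\<lambda>z. r *\<^sub>R z + t) ` S \<in> lmeasurable"
proof (rule measurable_convex)
  have "(\<lambda>z. r *\<^sub>R z + t) ` S = (\<lambda>z. t + z) ` (\<lambda>z. r *\<^sub>R z) ` S"
    by (simp add: image_image add.commute)
  then show "convex ((\<lambda>z. r *\<^sub>R z + t) ` S)" "bounded ((\<lambda>z. r *\<^sub>R z + t) ` S)"
    using assms by (simp_all add: convex_translation convex_scaling bounded_translation bounded_scaling)
qed

text \<open>The contraction towards \<open>y\<close> with ratio \<open>1 - s\<close> takes
  \<open>q\<close> to \<open>q'\<close> and halfspaces to parallel ones, so the cap at
  \<open>q\<close> lands in the cap at \<open>q'\<close> with the same normal \<open>v\<close>.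
  Volumes scale by the ratio to the power of the dimension.\<close>

lemma measure_cap_le:
  fixes K :: "(real ^ 'n) set"
  assumes "convex K" "bounded K" "y \<in> K" "0 \<le> s" "s \<le> 1"
    and q': "q' = (1 - s) *\<^sub>R q + s *\<^sub>R y"
  shows "(1 - s) ^ CARD('n) * measure lebesgue {z \<in> K. v \<bullet> (z - q) \<ge> 0}
     \<le> measure lebesgue {z \<in> K. v \<bullet> (z - q') \<ge> 0}"
proof -
  let ?C = "{z \<in> K. v \<bullet> (z - q) \<ge> 0}" and ?f = "\<lambda>z. (1 - s) *\<^sub>R z + s *\<^sub>R y"
  have "?f ` ?C \<subseteq> {z \<in> K. v \<bullet> (z - q') \<ge> 0}"
  proof clarify
    fix z assume z: "z \<in> K" "v \<bullet> (z - q) \<ge> 0"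
    have "?f z - q' = (1 - s) *\<^sub>R (z - q)" by (simp add: q' algebra_simps)
    then show "?f z \<in> K \<and> 0 \<le> v \<bullet> (?f z - q')"
      using assms z by (simp add: convexD)
  qed
  moreover have "?f ` ?C \<in> sets lebesgue"
    using assms by (intro fmeasurableD lmeasurable_convex_affinity convex_bounded_cap)
  ultimately have "measure lebesgue (?f ` ?C) \<le> measure lebesgue {z \<in> K. v \<bullet> (z - q') \<ge> 0}"
    using assms
    by (intro measure_mono_fmeasurable measurable_convex convex_bounded_cap) auto
  then show ?thesis
    using assms measure_lebesgue_affine[of "1 - s" "s *\<^sub>R y" ?C] by simp
qed

lemma halfspace_depth_le:
  fixes K :: "(real ^ 'n) set"
  assumes "norm v = 1"
  shows "halfspace_depth K q \<le> measure lebesgue {z \<in> K. v \<bullet> (z - q) \<ge> 0} / measure lebesgue K"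
  unfolding halfspace_depth_def
  using assms by (intro cInf_lower bdd_belowI[of _ 0]) auto

lemma halfspace_depth_ge:
  fixes K :: "(real ^ 'n) set"
  assumes "\<And>v. norm v = 1 \<Longrightarrow> x \<le> measure lebesgue {z \<in> K. v \<bullet> (z - q) \<ge> 0} / measure lebesgue K"
  shows "x \<le> halfspace_depth K q"
proof -
  obtain v :: "real ^ 'n" where "norm v = 1" using vector_choose_size[of 1] by auto
  then show ?thesis
    unfolding halfspace_depth_def using assms by (intro cInf_greatest) auto
qed

text \<open>The same normal occurs on both sides of \<open>measure_cap_le\<close>, so the bound
  passes to the infimum over all directions.\<close>

lemma halfspace_depth_contract:
  fixes K :: "(real ^ 'n) set"
  assumes "convex K" "bounded K" "y \<in> K" "0 \<le> s" "s \<le> 1"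
    and q': "q' = (1 - s) *\<^sub>R q + s *\<^sub>R y"
  shows "(1 - s) ^ CARD('n) * halfspace_depth K q \<le> halfspace_depth K q'"
proof (rule halfspace_depth_ge)
  fix v :: "real ^ 'n" assume v: "norm v = 1"
  have "(1 - s) ^ CARD('n) * halfspace_depth K q \<le>
      (1 - s) ^ CARD('n) * (measure lebesgue {z \<in> K. v \<bullet> (z - q) \<ge> 0} / measure lebesgue K)"
    using assms by (intro mult_left_mono halfspace_depth_le v) auto
  also have "\<dots> \<le> measure lebesgue {z \<in> K. v \<bullet> (z - q') \<ge> 0} / measure lebesgue K"
    using divide_right_mono[OF measure_cap_le[OF assms, of v], of "measure lebesgue K"] by simp
  finally show "(1 - s) ^ CARD('n) * halfspace_depth K q
      \<le> measure lebesgue {z \<in> K. v \<bullet> (z - q') \<ge> 0} / measure lebesgue K" .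
qed

section \<open>Volume of thin caps\<close>

text \<open>Shrinking a thin cap towards a far point of the body by the factors \<open>1 - j * \<sigma> \<ge> 1/2\<close> gives
  more than \<open>1 / (2 * \<sigma>)\<close> disjoint copies inside the body.\<close>

lemma measure_thin_cap_le:
  fixes K :: "(real ^ 'n) set"
  assumes K: "convex K" "bounded K" and g: "g \<in> K"
    and le: "\<And>z. z \<in> K \<Longrightarrow> v \<bullet> z \<le> m"
    and \<sigma>: "0 < \<sigma>" and thin: "m - v \<bullet> q < \<sigma> * (m - v \<bullet> g)" and gm: "v \<bullet> g < m"
  shows "measure lebesgue {z \<in> K. v \<bullet> (z - q) \<ge> 0} \<le> 2 ^ Suc CARD('n) * \<sigma> * measure lebesgue K"
proof -
  define C where "C = {z \<in> K. v \<bullet> (z - q) \<ge> 0}"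
  define G where "G = m - v \<bullet> g"
  have G: "G > 0" using gm by (simp add: G_def)
  have C: "convex C" "bounded C" unfolding C_def by (intro convex_bounded_cap K)+
  define f where "f j z = (1 - real j * \<sigma>) *\<^sub>R z + (real j * \<sigma>) *\<^sub>R g" for j and z :: "real ^ 'n"
  define J where "J = {j. real j * \<sigma> \<le> 1 / 2}"
  have J: "J = {..nat \<lfloor>1 / (2 * \<sigma>)\<rfloor>}"
  proof -
    have "real j * \<sigma> \<le> 1 / 2 \<longleftrightarrow> real j \<le> 1 / (2 * \<sigma>)" for j
      using \<sigma> by (simp add: field_simps)
    also have "\<dots> j \<longleftrightarrow> j \<le> nat \<lfloor>1 / (2 * \<sigma>)\<rfloor>" for j
      using \<sigma> by (simp add: le_nat_floor le_nat_iff le_floor_iff)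
    finally show ?thesis by (auto simp: J_def)
  qed
  have fm: "f j ` C \<in> lmeasurable" for j
    unfolding f_def by (intro lmeasurable_convex_affinity C)
  \<comment> \<open>The contraction multiplies the gap \<open>m - v \<bullet> z\<close> by
    \<open>1 - real j * \<sigma>\<close> and adds \<open>real j * \<sigma> * G\<close>. Gaps in
    \<open>C\<close> are below \<open>\<sigma> * G\<close>, so the copies lie in consecutive
    half-open slabs, which are disjoint.\<close>
  have range_f: "real j * \<sigma> * G \<le> m - v \<bullet> f j z \<and> m - v \<bullet> f j z < real (Suc j) * \<sigma> * G"
    if "j \<in> J" "z \<in> C" for j z
  proof -
    have j: "0 \<le> real j * \<sigma>" "real j * \<sigma> \<le> 1 / 2" using that \<sigma> by (auto simp: J_def)
    have "0 \<le> m - v \<bullet> z" "m - v \<bullet> z < \<sigma> * G"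
      using that le thin by (auto simp: C_def G_def inner_diff_right)
    then have "0 \<le> (1 - real j * \<sigma>) * (m - v \<bullet> z)" "(1 - real j * \<sigma>) * (m - v \<bullet> z) < \<sigma> * G"
      using j mult_right_mono[of "1 - real j * \<sigma>" 1 "m - v \<bullet> z"] by auto
    moreover have "m - v \<bullet> f j z = (1 - real j * \<sigma>) * (m - v \<bullet> z) + real j * \<sigma> * G"
      by (simp add: f_def G_def inner_add_right algebra_simps)
    ultimately show ?thesis by (simp add: algebra_simps)
  qed
  have disj: "pairwise (\<lambda>i j. disjnt (f i ` C) (f j ` C)) J"
  proof -
    have aux: "f i x \<noteq> f j z" if "i \<in> J" "j \<in> J" "x \<in> C" "z \<in> C" "i < j" for i j x z
    proof
      assume eq: "f i x = f j z"
      have "real (Suc i) * \<sigma> * G \<le> real j * \<sigma> * G"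
        using that \<sigma> G by (intro mult_right_mono) auto
      with range_f[OF that(1,3)] range_f[OF that(2,4)] eq show False by simp
    qed
    show ?thesis
      unfolding pairwise_def disjnt_iff
      using aux by (metis imageE linorder_neqE_nat)
  qed
  have "real (card J) * (measure lebesgue C / 2 ^ CARD('n)) \<le> (\<Sum>j\<in>J. measure lebesgue (f j ` C))"
  proof (rule sum_bounded_below)
    fix j assume "j \<in> J"
    then have j: "0 \<le> real j * \<sigma>" "real j * \<sigma> \<le> 1 / 2" using \<sigma> by (auto simp: J_def)
    have "measure lebesgue C / 2 ^ CARD('n) = (1/2) ^ CARD('n) * measure lebesgue C"
      by (simp add: power_divide)
    also have "\<dots> \<le> (1 - real j * \<sigma>) ^ CARD('n) * measure lebesgue C"
      using j by (intro mult_right_mono power_mono) auto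
    also have "\<dots> = measure lebesgue (f j ` C)"
      unfolding f_def using j measure_lebesgue_affine[of "1 - real j * \<sigma>" "(real j * \<sigma>) *\<^sub>R g" C]
      by simp
    finally show "measure lebesgue C / 2 ^ CARD('n) \<le> measure lebesgue (f j ` C)" .
  qed
  also have "\<dots> = measure lebesgue (\<Union>j\<in>J. f j ` C)"
    using fm disj J by (intro measure_UNION'[symmetric]) auto
  also have "\<dots> \<le> measure lebesgue K"
  proof (rule measure_mono_fmeasurable)
    show "(\<Union>j\<in>J. f j ` C) \<subseteq> K"
      using K g \<sigma> by (auto simp: f_def C_def J_def intro!: convexD)
    show "(\<Union>j\<in>J. f j ` C) \<in> sets lebesgue"
      using fm J by (intro sets.finite_UN fmeasurableD) auto
    show "K \<in> lmeasurable" using K by (intro measurable_convex)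
  qed
  finally have *: "real (card J) * (measure lebesgue C / 2 ^ CARD('n)) \<le> measure lebesgue K" .
  \<comment> \<open>\<open>J\<close> starts at 0, so its cardinality exceeds the floor by one, which
    makes up for the rounding.\<close>
  have "1 / (2 * \<sigma>) \<le> real (card J)" using J \<sigma> by simp linarith
  then have "1 / (2 * \<sigma>) * (measure lebesgue C / 2 ^ CARD('n)) \<le> measure lebesgue K"
    using * by (meson divide_nonneg_nonneg measure_nonneg mult_right_mono order_trans
        zero_le_numeral zero_le_power)
  then show ?thesis using \<sigma> by (simp add: C_def field_simps)
qed

section \<open>Coordinates adapted to the body\<close>

text \<open>The frame has at least half of the maximal determinant.  By Cramer's rule a coordinate larger
  than 2 would allow to double the determinant.\<close>

lemma ex_inscribed_frame:
  fixes K :: "(real ^ 'n) set"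
  assumes "open K" "bounded K" "K \<noteq> {}"
  obtains p and A B :: "real ^ 'n ^ 'n" where "p \<in> K" "\<And>i. p + column i A \<in> K" "A ** B = mat 1"
    "\<And>z i. z \<in> K \<Longrightarrow> \<bar>(B *v (z - p)) $ i\<bar> \<le> 2"
proof -
  obtain p where p: "p \<in> K" using assms by auto
  define S where "S = {A :: real ^ 'n ^ 'n. \<forall>i. p + column i A \<in> K}"
  obtain R where R: "\<And>x. x \<in> K \<Longrightarrow> norm (x - p) \<le> R"
    using bounded_translation[OF assms(2), of "-p"] unfolding bounded_iff by force
  define D where "D = (\<lambda>A :: real ^ 'n ^ 'n. \<bar>det A\<bar>) ` S"
  \<comment> \<open>By the Leibniz formula it is enough to bound the entries, and each column is a
    difference of two points of the bounded set \<open>K\<close>.\<close>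
  have bdd: "bdd_above D"
  proof (rule bdd_aboveI)
    fix x assume "x \<in> D"
    then obtain A where A: "\<And>i. p + column i A \<in> K" "x = \<bar>det A\<bar>" by (auto simp: D_def S_def)
    have entry: "\<bar>A $ i $ j\<bar> \<le> R" for i j
    proof -
      have "\<bar>column j A $ i\<bar> \<le> norm (column j A)" by (rule component_le_norm_cart)
      also have "\<dots> \<le> R" using R[OF A(1)[of j]] by simp
      finally show ?thesis by (simp add: column_def)
    qed
    have "\<bar>det A\<bar> \<le> (\<Sum>\<pi>\<in>{\<pi>. \<pi> permutes (UNIV :: 'n set)}. \<bar>of_int (sign \<pi>) * (\<Prod>i\<in>UNIV. A $ i $ \<pi> i)\<bar>)"
      unfolding det_def by (rule sum_abs)
    also have "\<dots> \<le> (\<Sum>\<pi>\<in>{\<pi>. \<pi> permutes (UNIV :: 'n set)}. R ^ CARD('n))"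
    proof (rule sum_mono)
      fix \<pi> :: "'n \<Rightarrow> 'n"
      have "(\<Prod>i\<in>UNIV. \<bar>A $ i $ \<pi> i\<bar>) \<le> (\<Prod>i\<in>(UNIV :: 'n set). R)"
        using entry by (intro prod_mono) auto
      then show "\<bar>of_int (sign \<pi>) * (\<Prod>i\<in>UNIV. A $ i $ \<pi> i)\<bar> \<le> R ^ CARD('n)"
        by (simp add: abs_mult abs_prod sign_def)
    qed
    finally show "x \<le> (\<Sum>\<pi>\<in>{\<pi>. \<pi> permutes (UNIV :: 'n set)}. R ^ CARD('n))" using A by simp
  qed
  obtain r where r: "r > 0" "cball p r \<subseteq> K" using assms p open_contains_cball by blast
  \<comment> \<open>A small multiple of the identity fits into \<open>K\<close> and makes the
    supremum of the determinants positive.\<close>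
  have "mat r \<in> S"
  proof -
    have "column i (mat r) = axis i r" for i :: 'n
      by (auto simp: column_def mat_def axis_def vec_eq_iff)
    moreover have "axis i r = r *\<^sub>R axis i (1 :: real)" for i :: 'n
      by (auto simp: axis_def vec_eq_iff)
    ultimately have "norm (column i (mat r :: real ^ 'n ^ 'n)) = r" for i :: 'n using r by simp
    then show ?thesis using r by (auto simp: S_def subset_iff dist_norm)
  qed
  moreover have "det (mat r :: real ^ 'n ^ 'n) = r ^ CARD('n)"
    by (subst det_diagonal) (auto simp: mat_def)
  ultimately have "r ^ CARD('n) \<in> D"
    using r by (auto simp: D_def image_iff intro!: bexI[of _ "mat r"])
  then have "r ^ CARD('n) \<le> Sup D" by (intro cSup_upper bdd)
  moreover have "0 < r ^ CARD('n)" using r by simp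
  ultimately have Sup_pos: "Sup D > 0" by linarith
  \<comment> \<open>As \<open>K\<close> is open, the supremum need not be attained. A frame above
    half of it suffices, and this factor is the 2 in the conclusion.\<close>
  then have "\<exists>x\<in>D. Sup D / 2 < x"
    using \<open>mat r \<in> S\<close> by (intro less_cSupD) (auto simp: D_def)
  then obtain A where A: "A \<in> S" "Sup D / 2 < \<bar>det A\<bar>" by (auto simp: D_def)
  then have "invertible A" using Sup_pos by (auto simp: invertible_det_nz)
  then obtain B where B: "A ** B = mat 1" by (auto simp: invertible_def)
  show ?thesis
  proof
    show "p \<in> K" "A ** B = mat 1" by fact+
    show "p + column i A \<in> K" for i using A by (auto simp: S_def)
    fix z i assume z: "z \<in> K"
    let ?x = "B *v (z - p)"
    have Ax: "A *v ?x = z - p" by (simp add: matrix_vector_mul_assoc B)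
    \<comment> \<open>Column \<open>i\<close> is exchanged for \<open>A *v ?x\<close>, the form that
      \<open>cramer_lemma\<close> expects. This vector is \<open>z - p\<close>, so the new endpoint
      is \<open>z\<close> and the matrix is again in \<open>S\<close>.\<close>
    let ?A' = "(\<chi> k j. if j = i then (A *v ?x) $ k else A $ k $ j) :: real ^ 'n ^ 'n"
    have "column j ?A' = (if j = i then z - p else column j A)" for j
      by (auto simp: column_def vec_eq_iff Ax)
    then have "?A' \<in> S" using A z by (auto simp: S_def)
    then have "\<bar>det ?A'\<bar> \<le> Sup D" using bdd by (intro cSup_upper) (auto simp: D_def)
    then have "\<bar>?x $ i\<bar> * \<bar>det A\<bar> \<le> Sup D" by (simp add: cramer_lemma abs_mult)
    also have "\<dots> \<le> 2 * \<bar>det A\<bar>" using A by simp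
    finally show "\<bar>?x $ i\<bar> \<le> 2" using A Sup_pos by (auto dest: mult_right_le_imp_le)
  qed
qed

section \<open>Depth in the neighbourhood of a deep point\<close>

text \<open>If \<open>q + h\<close> were outside \<open>K\<close>, a hyperplane through it would
  have \<open>K\<close> on one side. As \<open>h\<close> is small in the frame coordinates while the
  frame gives \<open>K\<close> a definite width in every direction, the parallel cap at
  \<open>q\<close> would be thin, and \<open>measure_thin_cap_le\<close> would force the depth of
  \<open>q\<close> down to at most \<open>\<epsilon>\<close>.\<close>

lemma deep_point_neighborhood:
  fixes K :: "(real ^ 'n) set" and A B :: "real ^ 'n ^ 'n"
  assumes K: "convex K" "bounded K" and p: "p \<in> K" "\<And>i. p + column i A \<in> K"
    and AB: "A ** B = mat 1" and \<epsilon>: "0 < \<epsilon>" and deep: "\<epsilon> < halfspace_depth K q"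
    and h: "\<And>i. \<bar>(B *v h) $ i\<bar> \<le> \<epsilon> / (2 ^ (CARD('n) + 2) * CARD('n))"
  shows "q + h \<in> K"
proof (rule ccontr)
  assume notin: "q + h \<notin> K"
  define d where "d = real CARD('n)"
  have d: "d \<ge> 1" unfolding d_def by (simp add: Suc_le_eq)
  have "0 \<notin> (\<lambda>z. (q + h) - z) ` K" using notin by auto
  moreover have "convex ((\<lambda>z. (q + h) - z) ` K)" 
    using convex_translation[OF convex_negations[OF K(1)], of "q + h"] by (simp add: image_image)
  ultimately obtain u where u: "u \<noteq> 0" "\<And>z. z \<in> K \<Longrightarrow> 0 \<le> u \<bullet> ((q + h) - z)"
    using separating_hyperplane_set_0 by (metis imageI)
  define v where "v = u /\<^sub>R norm u"
  define m where "m = v \<bullet> (q + h)"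
  have v: "norm v = 1" using u by (simp add: v_def)
  have le: "v \<bullet> z \<le> m" if "z \<in> K" for z
    using u(2)[OF that] by (simp add: v_def m_def inner_diff_right mult_left_mono)
  let ?e = "\<lambda>i. v \<bullet> column i A"
  define W where "W = Max (range (\<lambda>i. \<bar>?e i\<bar>))"
  have W: "\<bar>?e i\<bar> \<le> W" for i unfolding W_def by (intro Max_ge) auto
  have "W \<in> range (\<lambda>i. \<bar>?e i\<bar>)" unfolding W_def by (intro Max_in) auto
  then obtain k where k: "W = \<bar>?e k\<bar>" by auto
  have expand: "v \<bullet> x = (\<Sum>i\<in>UNIV. (B *v x) $ i * ?e i)" for x
  proof -
    have "x = A *v (B *v x)" by (simp add: matrix_vector_mul_assoc AB)
    also have "\<dots> = (\<Sum>i\<in>UNIV. (B *v x) $ i *\<^sub>R column i A)"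
      unfolding matrix_mult_sum by (simp add: scalar_mult_eq_scaleR)
    finally show ?thesis by (metis (no_types, lifting) inner_scaleR_right inner_sum_right sum.cong)
  qed
  have W_pos: "W > 0"
  proof (rule ccontr)
    assume "\<not> W > 0"
    then have "?e i = 0" for i using W[of i] by simp
    then have "v \<bullet> v = 0" by (subst expand) simp
    then show False using v by auto
  qed
  \<comment> \<open>The points \<open>p\<close> and \<open>p + column k A\<close> differ by
    \<open>W\<close> in direction \<open>v\<close>. The upper one is at most at level
    \<open>m\<close>, so the lower one serves as \<open>g\<close>.\<close>
  have "\<exists>g\<in>K. W \<le> m - v \<bullet> g"
  proof (cases "?e k \<ge> 0")
    case True
    then show ?thesis using le[OF p(2)[of k]] k p by (intro bexI[of _ p]) (auto simp: inner_add_right)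
  next
    case False
    then show ?thesis
      using le[OF p(1)] k p by (intro bexI[of _ "p + column k A"]) (auto simp: inner_add_right)
  qed
  then obtain g where g: "g \<in> K" "W \<le> m - v \<bullet> g" by auto
  \<comment> \<open>Chosen so that the factor \<open>2 ^ Suc CARD('n) * \<sigma>\<close> of the thin
    cap bound is exactly \<open>\<epsilon>\<close>. The hypothesis on \<open>h\<close> bounds each
    coordinate by \<open>\<sigma> / (2 * d)\<close>, so that the sum over all coordinates leaves a
    spare factor 2 for the strict inequality.\<close>
  define \<sigma> where "\<sigma> = \<epsilon> / 2 ^ (CARD('n) + 1)"
  have \<sigma>: "\<sigma> > 0" using \<epsilon> by (simp add: \<sigma>_def)
  have "v \<bullet> h \<le> (\<Sum>i\<in>(UNIV :: 'n set). \<sigma> / (2 * d) * W)"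
    unfolding expand[of h]
  proof (rule sum_mono)
    fix i
    have "(B *v h) $ i * ?e i \<le> \<bar>(B *v h) $ i\<bar> * \<bar>?e i\<bar>" by (simp add: abs_mult[symmetric])
    also have "\<dots> \<le> \<sigma> / (2 * d) * W"
      using h[of i] W[of i] d \<sigma> by (intro mult_mono) (auto simp: \<sigma>_def d_def)
    finally show "(B *v h) $ i * ?e i \<le> \<sigma> / (2 * d) * W" .
  qed
  also have "\<dots> = \<sigma> * W / 2" using d by (simp add: d_def)
  also have "\<dots> < \<sigma> * W" using \<sigma> W_pos by simp
  also have "\<dots> \<le> \<sigma> * (m - v \<bullet> g)" using \<sigma> g by simp
  finally have "m - v \<bullet> q < \<sigma> * (m - v \<bullet> g)" by (simp add: m_def inner_add_right)
  then have "measure lebesgue {z \<in> K. v \<bullet> (z - q) \<ge> 0}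
      \<le> 2 ^ Suc CARD('n) * \<sigma> * measure lebesgue K"
    using K g \<sigma> le W_pos by (intro measure_thin_cap_le[of K g v m]) auto
  \<comment> \<open>If \<open>K\<close> is a null set, the quotient is 0 by convention.\<close>
  then have "measure lebesgue {z \<in> K. v \<bullet> (z - q) \<ge> 0} / measure lebesgue K \<le> \<epsilon>"
    using \<epsilon> by (cases "measure lebesgue K = 0")
      (auto simp: \<sigma>_def divide_le_eq zero_less_measure_iff)
  then show False using halfspace_depth_le[OF v, of K q] deep by simp
qed

text \<open>\<open>q'\<close> is the contraction of \<open>q\<close> with ratio \<open>1 - s\<close>
  towards \<open>q + h\<close>, where \<open>h\<close> is \<open>q' - q\<close> stretched by
  \<open>1 / s\<close>. The tolerance is \<open>s\<close> times that of
  \<open>deep_point_neighborhood\<close>, which puts \<open>q + h\<close> into \<open>K\<close>.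
  With \<open>s = \<epsilon> / CARD('n)\<close>, the loss \<open>(1 - s) ^ CARD('n)\<close> is at
  least \<open>1 - \<epsilon>\<close> by Bernoulli's inequality.\<close>

lemma halfspace_depth_near:
  fixes K :: "(real ^ 'n) set" and A B :: "real ^ 'n ^ 'n"
  assumes K: "convex K" "bounded K" and p: "p \<in> K" "\<And>i. p + column i A \<in> K"
    and AB: "A ** B = mat 1" and \<epsilon>: "0 < \<epsilon>" "\<epsilon> < 1" and deep: "\<epsilon> < halfspace_depth K q"
    and near: "\<And>i. \<bar>(B *v (q' - q)) $ i\<bar> \<le> \<epsilon>\<^sup>2 / (2 ^ (CARD('n) + 2) * CARD('n) ^ 2)"
  shows "(1 - \<epsilon>) * halfspace_depth K q \<le> halfspace_depth K q'"
proof -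
  define s where "s = \<epsilon> / CARD('n)"
  have "1 \<le> real CARD('n)" by (simp add: Suc_le_eq)
  then have "\<epsilon> \<le> real CARD('n)" using \<epsilon> by linarith
  then have s: "0 < s" "s \<le> 1" using \<epsilon> by (auto simp: s_def divide_le_eq)
  define h where "h = (q' - q) /\<^sub>R s"
  have "q + h \<in> K"
  proof (rule deep_point_neighborhood[OF K p AB \<epsilon>(1) deep])
    fix i
    have "\<bar>(B *v h) $ i\<bar> = \<bar>(B *v (q' - q)) $ i\<bar> / s"
      using s by (simp add: h_def matrix_vector_mult_scaleR abs_mult divide_inverse_commute)
    also have "\<dots> \<le> \<epsilon>\<^sup>2 / (2 ^ (CARD('n) + 2) * CARD('n) ^ 2) / s"
      using near s by (intro divide_right_mono) auto
    also have "\<dots> = \<epsilon> / (2 ^ (CARD('n) + 2) * CARD('n))"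
      using \<epsilon> by (simp add: s_def power2_eq_square field_simps)
    finally show "\<bar>(B *v h) $ i\<bar> \<le> \<epsilon> / (2 ^ (CARD('n) + 2) * CARD('n))" .
  qed
  moreover have "q' = (1 - s) *\<^sub>R q + s *\<^sub>R (q + h)"
    using s by (simp add: h_def algebra_simps)
  ultimately have "(1 - s) ^ CARD('n) * halfspace_depth K q \<le> halfspace_depth K q'"
    using K s by (intro halfspace_depth_contract) auto
  moreover have "1 - \<epsilon> \<le> (1 - s) ^ CARD('n)"
    using Bernoulli_inequality[of "-s" "CARD('n)"] s by (simp add: s_def)
  ultimately show ?thesis
    using deep \<epsilon> mult_right_mono[of "1 - \<epsilon>" "(1 - s) ^ CARD('n)" "halfspace_depth K q"] by linarith
qed

section \<open>Composition of program runs\<close>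

text \<open>Stated in continuation form: a run from the later state extends to one from the earlier
  state. This composes by adding the bounds \<open>T\<close> and leaves the exact number of steps
  open, as the scan has a data-dependent length.\<close>

definition reaches ::
  "'n instr list \<Rightarrow> real ^ 'n \<Rightarrow> nat \<Rightarrow> nat \<Rightarrow> memory \<Rightarrow> nat \<Rightarrow> memory \<Rightarrow> bool" where
  "reaches P q T pc M pc' M' \<longleftrightarrow>
     (\<exists>n\<le>T. \<forall>t v. runs P q pc' M' t v \<longrightarrow> runs P q pc M (n + t) v)"

lemma reaches_refl: "reaches P q 0 pc M pc M"
  by (auto simp: reaches_def)

lemma reaches_mono: "reaches P q T pc M pc' M' \<Longrightarrow> T \<le> T' \<Longrightarrow> reaches P q T' pc M pc' M'"
  unfolding reaches_def by (meson order_trans)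

lemma reaches_trans:
  assumes "reaches P q T pc M pc' M'" "reaches P q T' pc' M' pc'' M''"
  shows "reaches P q (T + T') pc M pc'' M''"
proof -
  obtain n n' where "n \<le> T" "\<And>t v. runs P q pc' M' t v \<Longrightarrow> runs P q pc M (n + t) v"
    and "n' \<le> T'" "\<And>t v. runs P q pc'' M'' t v \<Longrightarrow> runs P q pc' M' (n' + t) v"
    using assms unfolding reaches_def by blast
  then show ?thesis
    unfolding reaches_def by (intro exI[of _ "n + n'"]) (auto simp: add.assoc)
qed

lemma reaches_step:
  assumes "pc < length P" "exec_instr q (P ! pc) (pc, M) = Some (pc1, M1)"
    and "reaches P q T pc1 M1 pc' M'"
  shows "reaches P q (Suc T) pc M pc' M'"
proof -
  obtain n where "n \<le> T" "\<And>t v. runs P q pc' M' t v \<Longrightarrow> runs P q pc1 M1 (n + t) v"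
    using assms(3) unfolding reaches_def by blast
  then show ?thesis
    unfolding reaches_def using runs.step[OF assms(1,2)] by (intro exI[of _ "Suc n"]) auto
qed

text \<open>Jump targets are absolute, so a fragment is verified at its position in the whole
  program rather than as a program of its own.\<close>

fun code_at :: "'n instr list \<Rightarrow> nat \<Rightarrow> 'n instr list \<Rightarrow> bool" where
  "code_at P pc [] \<longleftrightarrow> True"
| "code_at P pc (a # B) \<longleftrightarrow> pc < length P \<and> P ! pc = a \<and> code_at P (Suc pc) B"

lemma code_at_append:
  "code_at P pc (B @ C) \<longleftrightarrow> code_at P pc B \<and> code_at P (pc + length B) C"
  by (induction B arbitrary: pc) auto

lemma code_at_self: "code_at P 0 P"
proof -
  have "code_at (xs @ B) (length xs) B" for xs B :: "'a instr list"
  proof (induction B arbitrary: xs)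
    case (Cons a B)
    from Cons[of "xs @ [a]"] show ?case by simp
  qed simp
  from this[of "[]" P] show ?thesis by simp
qed

section \<open>The query program and the index that it computes\<close>

text \<open>Memory layout: cell 0 is the index being computed, cells 1 to 3 are scratch, cell 4 holds 1,
  cell 5 holds \<open>N + 1\<close>, cell 6 holds \<open>N\<close>, cell 7 holds the start of the table, and the
  coefficients of the affine coordinates start at cell 8.\<close>

fun dot_code :: "nat \<Rightarrow> 'n list \<Rightarrow> 'n instr list" where
  "dot_code r [] = []"
| "dot_code r (j # js) = [Input 1 j, Mul 1 1 r, Add 2 2 1] @ dot_code (Suc r) js"

text \<open>The affine coordinate is accumulated in cell 2, and cell 3 counts up from 0 until it
  reaches that value or \<open>N\<close>. \<open>JumpLe 3 3 l\<close> always jumps, and the last two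
  instructions are a Horner step in base \<open>N + 1\<close>. The argument \<open>pc\<close> serves
  to compute the jump targets.\<close>

definition row_code :: "nat \<Rightarrow> 'n list \<Rightarrow> nat \<Rightarrow> 'n instr list" where
  "row_code r js pc = (let l = pc + 3 * length js + 3 in
     [Const 3 0, Const 2 0] @ dot_code r js @ [Add 2 2 (r + length js),
      JumpLe 2 3 (l + 4), JumpLe 6 3 (l + 4), Add 3 3 4, JumpLe 3 3 l, Mul 0 0 5, Add 0 0 3])"

fun rows_code :: "'n list \<Rightarrow> nat \<Rightarrow> 'n instr list" where
  "rows_code js 0 = []"
| "rows_code js (Suc m) =
     rows_code js m @ row_code (8 + m * Suc (length js)) js (m * (3 * length js + 9))"

definition query_code :: "'n list \<Rightarrow> 'n instr list" where
  "query_code js = rows_code js (length js) @ [Add 0 0 7, Load 1 0, Return 1]"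

lemma length_dot_code: "length (dot_code r js) = 3 * length js"
  by (induction js arbitrary: r) auto

lemma length_row_code: "length (row_code r js pc) = 3 * length js + 9"
  by (simp add: row_code_def length_dot_code)

lemma length_rows_code: "length (rows_code js m) = m * (3 * length js + 9)"
  by (induction m) (auto simp: length_row_code)

definition row_val :: "memory \<Rightarrow> nat \<Rightarrow> 'n list \<Rightarrow> real ^ 'n \<Rightarrow> real" where
  "row_val M r js q = (\<Sum>m<length js. M (r + m) * q $ (js ! m)) + M (r + length js)"

text \<open>This is the value at which the scan stops. Cells 1 to \<open>N - 1\<close> are unit
  intervals, while 0 and \<open>N\<close> are unbounded and catch all points off the grid.\<close>

definition cell_index :: "nat \<Rightarrow> real \<Rightarrow> nat" where
  "cell_index N x = min N (nat \<lceil>x\<rceil>)"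

text \<open>The cell indices are the digits of a number in base \<open>N + 1\<close>, most
  significant first, so that one table address encodes all coordinates.\<close>

fun grid_index :: "nat \<Rightarrow> (nat \<Rightarrow> real) \<Rightarrow> nat \<Rightarrow> nat" where
  "grid_index N x 0 = 0"
| "grid_index N x (Suc m) = grid_index N x m * Suc N + cell_index N (x m)"

section \<open>Correctness and running time of the query program\<close>

lemma dot_code_reaches:
  assumes "code_at P pc (dot_code r js)" "r > 2"
  shows "\<exists>M'. reaches P q (3 * length js) pc M (pc + 3 * length js) M'
    \<and> M' 2 = M 2 + (\<Sum>m<length js. M (r + m) * q $ (js ! m))
    \<and> (\<forall>a. a \<noteq> 1 \<and> a \<noteq> 2 \<longrightarrow> M' a = M a)"
  using assms
proof (induction js arbitrary: r pc M)
  case Nil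
  show ?case by (auto intro!: exI[of _ M] reaches_refl)
next
  case (Cons j js)
  define M1 where "M1 = M(1 := q $ j * M r, 2 := M 2 + q $ j * M r)"
  have c: "code_at P (pc + 3) (dot_code (Suc r) js)" using Cons.prems by (simp add: eval_nat_numeral)
  obtain M' where M': "reaches P q (3 * length js) (pc + 3) M1 (pc + 3 + 3 * length js) M'"
    "M' 2 = M1 2 + (\<Sum>m<length js. M1 (Suc r + m) * q $ (js ! m))"
    "\<forall>a. a \<noteq> 1 \<and> a \<noteq> 2 \<longrightarrow> M' a = M1 a"
    using Cons.IH[OF c] Cons.prems by auto
  have "reaches P q (Suc (Suc (Suc (3 * length js)))) pc M (pc + 3 + 3 * length js) M'"
    using Cons.prems M'(1)
    by (auto intro!: reaches_step simp: M1_def eval_nat_numeral fun_upd_def cong: if_cong)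
  moreover have "Suc (Suc (Suc (3 * length js))) = 3 * length (j # js)"
    "pc + 3 + 3 * length js = pc + 3 * length (j # js)" by simp_all
  ultimately have "reaches P q (3 * length (j # js)) pc M (pc + 3 * length (j # js)) M'"
    by (simp only:)
  moreover have "(\<Sum>m<length js. M1 (Suc r + m) * q $ (js ! m))
      = (\<Sum>m<length js. M (Suc r + m) * q $ (js ! m))"
    using Cons.prems by (intro sum.cong) (auto simp: M1_def)
  ultimately show ?case
    using M'(2,3) Cons.prems
    by (intro exI[of _ M']) (auto simp: M1_def sum.lessThan_Suc_shift mult.commute
        simp del: sum.lessThan_Suc)
qed

text \<open>The invariant is that the counter \<open>k\<close> has not passed the target, and the
  induction is on \<open>N - k\<close>. A full pass costs four instructions, and the exit at most
  two.\<close>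

lemma scan_reaches:
  assumes "code_at P l [JumpLe 2 3 (l + 4), JumpLe 6 3 (l + 4), Add 3 3 4, JumpLe 3 3 l]"
    and "M 4 = 1" "M 6 = real N" "M 3 = real k" "k \<le> cell_index N (M 2)"
  shows "reaches P q (4 * (N - k) + 2) l M (l + 4) (M(3 := real (cell_index N (M 2))))"
  using assms
proof (induction "N - k" arbitrary: k M)
  case 0
  then have k: "cell_index N (M 2) = k" "N = k" by (auto simp: cell_index_def)
  have "reaches P q 2 l M (l + 4) M"
  proof (cases "M 2 \<le> M 3")
    case True
    with 0 have "reaches P q (Suc 0) l M (l + 4) M"
      by (auto intro!: reaches_step reaches_refl)
    then show ?thesis by (rule reaches_mono) simp
  next
    case False
    with 0 k have "reaches P q (Suc (Suc 0)) l M (l + 4) M"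
      by (auto intro!: reaches_step reaches_refl)
    then show ?thesis by (simp add: numeral_2_eq_2)
  qed
  then have "reaches P q (4 * (N - k) + 2) l M (l + 4) M" by (rule reaches_mono) simp
  moreover have "M(3 := real (cell_index N (M 2))) = M" using 0 k by auto
  ultimately show ?case by (simp only:)
next
  case (Suc n)
  show ?case
  proof (cases "M 2 \<le> M 3")
    case True
    with Suc.prems have "M 2 \<le> real k" by simp
    then have "nat \<lceil>M 2\<rceil> \<le> k" by (simp add: nat_le_iff ceiling_le_iff)
    then have "cell_index N (M 2) \<le> k" unfolding cell_index_def by (rule min.coboundedI2)
    with Suc.prems have "cell_index N (M 2) = k" by simp
    then have "M(3 := real (cell_index N (M 2))) = M" using Suc by auto
    moreover from True Suc.prems have "reaches P q (Suc 0) l M (l + 4) M"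
      by (auto intro!: reaches_step reaches_refl)
    then have "reaches P q (4 * (N - k) + 2) l M (l + 4) M" by (rule reaches_mono) simp
    ultimately show ?thesis by simp
  next
    case False
    define M1 where "M1 = M(3 := real (Suc k))"
    have kN: "k < N" using Suc by simp
    have "Suc k \<le> cell_index N (M1 2)"
      using False kN Suc.prems by (auto simp: cell_index_def M1_def less_ceiling_iff Suc_le_eq zless_nat_eq_int_zless)
    then have "reaches P q (4 * (N - Suc k) + 2) l M1 (l + 4) (M1(3 := real (cell_index N (M1 2))))"
      using Suc.hyps(2) Suc.prems by (intro Suc.hyps(1)) (auto simp: M1_def)
    note IH = this
    have s: "exec_instr q (P ! l) (l, M) = Some (Suc l, M)"
      "exec_instr q (P ! Suc l) (Suc l, M) = Some (Suc (Suc l), M)"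
      "exec_instr q (P ! Suc (Suc l)) (Suc (Suc l), M) = Some (Suc (Suc (Suc l)), M1)"
      "exec_instr q (P ! Suc (Suc (Suc l))) (Suc (Suc (Suc l)), M1) = Some (l, M1)"
      using False kN Suc.prems by (auto simp: M1_def add.commute)
    have "reaches P q (Suc (Suc (Suc (Suc (4 * (N - Suc k) + 2))))) l M (l + 4)
        (M1(3 := real (cell_index N (M1 2))))"
      using Suc.prems(1) by (intro s[THEN reaches_step[rotated]] IH) auto
    moreover have "M1(3 := real (cell_index N (M1 2))) = M(3 := real (cell_index N (M 2)))"
      by (simp add: M1_def)
    moreover have "Suc (Suc (Suc (Suc (4 * (N - Suc k) + 2)))) = 4 * (N - k) + 2"
      using kN by simp
    ultimately show ?thesis by simp
  qed
qed

lemma row_code_reaches: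
  assumes code: "code_at P pc (row_code r js pc)" and r: "r > 7"
    and M: "M 4 = 1" "M 5 = real (Suc N)" "M 6 = real N"
  shows "\<exists>M'. reaches P q (4 * N + 3 * length js + 7) pc M (pc + (3 * length js + 9)) M'
    \<and> M' 0 = M 0 * real (Suc N) + real (cell_index N (row_val M r js q))
    \<and> (\<forall>a\<ge>4. M' a = M a)"
proof -
  let ?n = "3 * length js"
  define l where "l = pc + ?n + 3"
  define M0 where "M0 = M(3 := 0, 2 := 0)"
  have c: "code_at P pc [Const 3 0, Const 2 0]" "code_at P (pc + 2) (dot_code r js)"
    "code_at P (pc + 2 + ?n) [Add 2 2 (r + length js)]"
    "code_at P l [JumpLe 2 3 (l + 4), JumpLe 6 3 (l + 4), Add 3 3 4, JumpLe 3 3 l]"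
    "code_at P (l + 4) [Mul 0 0 5, Add 0 0 3]"
    using code unfolding row_code_def Let_def code_at_append
    by (simp_all add: length_dot_code l_def eval_nat_numeral)
  have 1: "reaches P q (Suc (Suc 0)) pc M (pc + 2) M0"
    using c(1) by (auto intro!: reaches_step reaches_refl simp: M0_def)
  obtain M1 where M1: "reaches P q ?n (pc + 2) M0 (pc + 2 + ?n) M1"
    "M1 2 = M0 2 + (\<Sum>m<length js. M0 (r + m) * q $ (js ! m))"
    "\<forall>a. a \<noteq> 1 \<and> a \<noteq> 2 \<longrightarrow> M1 a = M0 a"
    using dot_code_reaches[OF c(2), of q M0] r by auto
  define M2 where "M2 = M1(2 := row_val M r js q)"
  have "(\<Sum>m<length js. M0 (r + m) * q $ (js ! m)) = (\<Sum>m<length js. M (r + m) * q $ (js ! m))"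
    using r by (intro sum.cong) (auto simp: M0_def)
  then have "M1 2 + M1 (r + length js) = row_val M r js q"
    using M1(2,3) r by (simp add: row_val_def M0_def)
  then have 2: "reaches P q (Suc 0) (pc + 2 + ?n) M1 l M2"
    using c(3) by (auto intro!: reaches_step reaches_refl simp: M2_def l_def eval_nat_numeral)
  have M2: "M2 3 = real 0" "M2 2 = row_val M r js q" "M2 0 = M 0" "\<forall>a\<ge>4. M2 a = M a"
    using M1(3) by (auto simp: M2_def M0_def)
  have 3: "reaches P q (4 * (N - 0) + 2) l M2 (l + 4)
      (M2(3 := real (cell_index N (row_val M r js q))))"
    using scan_reaches[OF c(4), of M2 N 0] M2 M by simp
  define M3 where "M3 = M2(3 := real (cell_index N (row_val M r js q)))"
  define M4 where "M4 = M3(0 := M 0 * real (Suc N) + real (cell_index N (row_val M r js q)))"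
  have s: "exec_instr q (P ! (l + 4)) (l + 4, M3) = Some (Suc (l + 4), M3(0 := M 0 * real (Suc N)))"
    "exec_instr q (P ! Suc (l + 4)) (Suc (l + 4), M3(0 := M 0 * real (Suc N))) = Some (pc + (?n + 9), M4)"
    using c(5) M2 M by (auto simp: M4_def M3_def l_def)
  have 4: "reaches P q (Suc (Suc 0)) (l + 4) M3 (pc + (?n + 9)) M4"
    using c(5) by (intro reaches_step[OF _ s(1)] reaches_step[OF _ s(2)] reaches_refl) auto
  \<comment> \<open>The summands are the two initialisations, the dot product, the constant term,
    the scan and the Horner step.\<close>
  have "reaches P q (Suc (Suc 0) + (?n + (Suc 0 + (4 * (N - 0) + 2 + Suc (Suc 0))))) pc M
      (pc + (?n + 9)) M4"
    using 1 M1(1) 2 3 4 unfolding M3_def[symmetric] by (blast intro: reaches_trans)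
  then have "reaches P q (4 * N + ?n + 7) pc M (pc + (?n + 9)) M4" by (rule reaches_mono) simp
  moreover have "\<forall>a\<ge>4. M4 a = M a" using M2 by (auto simp: M4_def M3_def)
  ultimately show ?thesis by (intro exI[of _ M4]) (simp add: M4_def)
qed

text \<open>Cells from 4 on survive each row, so every row still reads its original
  coefficients.\<close>

lemma rows_code_reaches:
  assumes "code_at P 0 (rows_code js n)"
    and M: "M 0 = 0" "M 4 = 1" "M 5 = real (Suc N)" "M 6 = real N"
  shows "\<exists>M'. reaches P q (n * (4 * N + 3 * length js + 7)) 0 M (n * (3 * length js + 9)) M'
    \<and> M' 0 = real (grid_index N (\<lambda>m. row_val M (8 + m * Suc (length js)) js q) n)
    \<and> (\<forall>a\<ge>4. M' a = M a)"
  using assms(1)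
proof (induction n)
  case 0
  show ?case using M by (auto intro!: exI[of _ M] reaches_refl)
next
  case (Suc n)
  let ?T = "4 * N + 3 * length js + 7" and ?L = "3 * length js + 9"
  let ?r = "8 + n * Suc (length js)"
  have c: "code_at P 0 (rows_code js n)" "code_at P (n * ?L) (row_code ?r js (n * ?L))"
    using Suc.prems by (simp_all add: code_at_append length_rows_code)
  obtain M1 where M1: "reaches P q (n * ?T) 0 M (n * ?L) M1"
    "M1 0 = real (grid_index N (\<lambda>m. row_val M (8 + m * Suc (length js)) js q) n)"
    "\<forall>a\<ge>4. M1 a = M a"
    using Suc.IH[OF c(1)] by auto
  obtain M2 where M2: "reaches P q ?T (n * ?L) M1 (n * ?L + ?L) M2"
    "M2 0 = M1 0 * real (Suc N) + real (cell_index N (row_val M1 ?r js q))"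
    "\<forall>a\<ge>4. M2 a = M1 a"
    using row_code_reaches[OF c(2), of M1 N q] M1 M by auto
  have "row_val M1 ?r js q = row_val M ?r js q"
    using M1(3) by (auto simp: row_val_def intro!: sum.cong)
  then have "M2 0 = real (grid_index N (\<lambda>m. row_val M (8 + m * Suc (length js)) js q) (Suc n))"
    using M1(2) M2(2) by (simp add: algebra_simps)
  moreover have "reaches P q (n * ?T + ?T) 0 M (n * ?L + ?L) M2"
    using M1(1) M2(1) by (rule reaches_trans)
  then have "reaches P q (Suc n * ?T) 0 M (Suc n * ?L) M2"
    by (simp only: mult_Suc add.commute)
  ultimately show ?case using M1(3) M2(3) by (intro exI[of _ M2]) auto
qed

text \<open>\<open>b \<ge> 4\<close> places the table beyond the cells that the program writes, so
  the entry read is that of the initial memory \<open>M\<close>. The extra 3 pays for the address,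
  the load and the return.\<close>

lemma query_code_runs:
  assumes M: "M 0 = 0" "M 4 = 1" "M 5 = real (Suc N)" "M 6 = real N" "M 7 = real b" and b: "b \<ge> 4"
  shows "\<exists>t. runs (query_code js) q 0 M t
      (M (b + grid_index N (\<lambda>m. row_val M (8 + m * Suc (length js)) js q) (length js)))
    \<and> t \<le> length js * (4 * N + 3 * length js + 7) + 3"
proof -
  let ?P = "query_code js" and ?x = "\<lambda>m. row_val M (8 + m * Suc (length js)) js q"
  let ?g = "grid_index N ?x (length js)" and ?T = "length js * (4 * N + 3 * length js + 7)"
  define e where "e = length js * (3 * length js + 9)"
  have c: "code_at ?P 0 (rows_code js (length js))" "code_at ?P e [Add 0 0 7, Load 1 0, Return 1]"
    using code_at_self[of ?P] unfolding query_code_def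
    by (simp_all only: code_at_append length_rows_code e_def add_0)
  obtain M1 where M1: "reaches ?P q ?T 0 M e M1" "M1 0 = real ?g" "\<forall>a\<ge>4. M1 a = M a"
    using rows_code_reaches[OF c(1) M(1-4)] unfolding e_def by blast
  define M2 where "M2 = M1(0 := real (?g + b))"
  define M3 where "M3 = M2(1 := M2 (?g + b))"
  have "M1 7 = real b" using M1 M by simp
  then have s1: "exec_instr q (?P ! e) (e, M1) = Some (Suc e, M2)"
    using c(2) M1 by (simp add: M2_def)
  have s2: "exec_instr q (?P ! Suc e) (Suc e, M2) = Some (Suc (Suc e), M3)"
  proof -
    have "M2 0 = real (?g + b)" by (simp add: M2_def)
    moreover have "nat \<lfloor>real (?g + b)\<rfloor> = ?g + b" by (metis floor_of_nat nat_int)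
    ultimately show ?thesis using c(2) by (simp add: M3_def del: of_nat_add)
  qed
  have "runs ?P q (Suc (Suc e)) M3 1 (M3 1)"
    using c(2) by (intro runs.return) auto
  then have "runs ?P q e M1 (Suc (Suc 1)) (M3 1)"
    using c(2) by (intro runs.step[OF _ s1] runs.step[OF _ s2]) auto
  moreover have "M3 1 = M (b + ?g)"
    using M1 b by (simp add: M3_def M2_def add.commute)
  ultimately have "runs ?P q e M1 3 (M (b + ?g))" by (simp add: eval_nat_numeral)
  then obtain n where "n \<le> ?T" "runs ?P q 0 M (n + 3) (M (b + ?g))"
    using M1(1) unfolding reaches_def by blast
  then show ?thesis by (intro exI[of _ "n + 3"]) auto
qed

section \<open>Grid cells and the table of answers\<close>

lemma cell_index_le: "cell_index N x \<le> N"
  by (simp add: cell_index_def)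

lemma grid_index_less: "grid_index N x m < Suc N ^ m"
proof (induction m)
  case (Suc m)
  have "grid_index N x (Suc m) < (grid_index N x m + 1) * Suc N"
    using cell_index_le[of N "x m"] by simp
  also have "\<dots> \<le> Suc N ^ m * Suc N" using Suc by (intro mult_right_mono) auto
  finally show ?case by (simp add: mult.commute)
qed simp

lemma grid_index_eqD:
  assumes "grid_index N x m = grid_index N y m" "i < m"
  shows "cell_index N (x i) = cell_index N (y i)"
  using assms
proof (induction m)
  case (Suc m)
  have *: "grid_index N z (Suc m) div Suc N = grid_index N z m"
    "grid_index N z (Suc m) mod Suc N = cell_index N (z m)" for z
    using cell_index_le[of N "z m"] by (simp_all add: div_mult_self3 less_Suc_eq_le del: mult_Suc_right)
  show ?case using Suc * by (metis less_Suc_eq)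
qed simp

text \<open>The bounds keep \<open>x\<close> out of the unbounded cells 0 and \<open>N\<close>, so
  equal cell indices mean equal ceilings. \<open>y\<close> is arbitrary, as the second point of a
  cell is not known to lie in \<open>K\<close>.\<close>

lemma cell_index_eqD:
  assumes "cell_index N x = cell_index N y" "0 < x" "x \<le> real N - 1"
  shows "\<bar>x - y\<bar> \<le> 1"
proof -
  have "nat \<lceil>x\<rceil> < N" "0 < nat \<lceil>x\<rceil>" using assms by linarith+
  then have "nat \<lceil>x\<rceil> = nat \<lceil>y\<rceil>" using assms by (auto simp: cell_index_def min_def split: if_splits)
  then have "\<lceil>x\<rceil> = \<lceil>y\<rceil>" using \<open>0 < nat \<lceil>x\<rceil>\<close> by linarith
  then show ?thesis by linarith
qed

text \<open>On \<open>K\<close> the frame coordinates are at most 2 in absolute value. Shifting by 3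
  makes them positive and at most 5, and scaling by \<open>L\<close>, the reciprocal of the
  tolerance in \<open>halfspace_depth_near\<close>, turns that tolerance into 1. The hypothesis on
  \<open>N\<close> then keeps \<open>K\<close> clear of the unbounded cells.\<close>

lemma ex_depth_grid:
  fixes K :: "(real ^ 'n) set"
  assumes K: "open_convex_body K" and \<epsilon>: "0 < \<epsilon>" "\<epsilon> < 1"
    and N: "5 * (2 ^ (CARD('n) + 2) * CARD('n) ^ 2 / \<epsilon>\<^sup>2) \<le> real N - 1"
  obtains a :: "'n \<Rightarrow> 'n \<Rightarrow> real" and b :: "'n \<Rightarrow> real" where
    "\<And>q q'. \<epsilon> < halfspace_depth K q \<Longrightarrow>
       (\<And>i. cell_index N ((\<Sum>j\<in>UNIV. a i j * q $ j) + b i)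
          = cell_index N ((\<Sum>j\<in>UNIV. a i j * q' $ j) + b i)) \<Longrightarrow>
       (1 - \<epsilon>) * halfspace_depth K q \<le> halfspace_depth K q'"
proof -
  have K': "convex K" "bounded K" "open K" "K \<noteq> {}" using K by (auto simp: open_convex_body_def)
  obtain p and A B :: "real ^ 'n ^ 'n" where p: "p \<in> K" "\<And>i. p + column i A \<in> K"
    and AB: "A ** B = mat 1" and B: "\<And>z i. z \<in> K \<Longrightarrow> \<bar>(B *v (z - p)) $ i\<bar> \<le> 2"
    using ex_inscribed_frame[OF K'(3,2,4)] by blast
  define L where "L = 2 ^ (CARD('n) + 2) * CARD('n) ^ 2 / \<epsilon>\<^sup>2"
  have L: "L > 0" using \<epsilon> by (simp add: L_def)
  define a where "a i j = L * B $ i $ j" for i j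
  define b where "b i = L * (3 - (B *v p) $ i)" for i
  have ab: "(\<Sum>j\<in>UNIV. a i j * q $ j) + b i = L * ((B *v (q - p)) $ i + 3)" for i q
    by (simp add: a_def b_def matrix_vector_mult_diff_distrib)
      (simp add: matrix_vector_mult_def sum_distrib_left mult.assoc algebra_simps)
  show ?thesis
  proof (rule that)
    fix q q' :: "real ^ 'n"
    assume deep: "\<epsilon> < halfspace_depth K q"
      and same: "\<And>i. cell_index N ((\<Sum>j\<in>UNIV. a i j * q $ j) + b i)
          = cell_index N ((\<Sum>j\<in>UNIV. a i j * q' $ j) + b i)"
    have "q \<in> K" using deep_point_neighborhood[OF K'(1,2) p AB \<epsilon>(1) deep, of 0] \<epsilon> by simp
    show "(1 - \<epsilon>) * halfspace_depth K q \<le> halfspace_depth K q'"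
    proof (rule halfspace_depth_near[OF K'(1,2) p AB \<epsilon> deep])
      fix i
      let ?y = "(B *v (q - p)) $ i" and ?y' = "(B *v (q' - p)) $ i"
      have y: "\<bar>?y\<bar> \<le> 2" using B \<open>q \<in> K\<close> .
      have "\<bar>L * (?y + 3) - L * (?y' + 3)\<bar> \<le> 1"
      proof (rule cell_index_eqD)
        show "cell_index N (L * (?y + 3)) = cell_index N (L * (?y' + 3))"
          using same[of i] by (simp add: ab)
        show "0 < L * (?y + 3)" using y L by (simp add: abs_le_iff)
        have "L * (?y + 3) \<le> L * 5" using y L by (intro mult_left_mono) (auto simp: abs_le_iff)
        then show "L * (?y + 3) \<le> real N - 1" using N by (simp add: L_def)
      qed
      moreover have "L * (?y + 3) - L * (?y' + 3) = - (L * (B *v (q' - q)) $ i)"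
        by (simp add: matrix_vector_mult_diff_distrib algebra_simps)
      ultimately have "\<bar>(B *v (q' - q)) $ i\<bar> \<le> 1 / L"
        using L by (simp add: abs_mult field_simps)
      then show "\<bar>(B *v (q' - q)) $ i\<bar> \<le> \<epsilon>\<^sup>2 / (2 ^ (CARD('n) + 2) * CARD('n) ^ 2)"
        by (simp add: L_def)
    qed
  qed
qed

text \<open>The threshold \<open>\<epsilon> / (1 - \<epsilon>)\<close> reconciles the two cases of a
  valid answer. One point above it lifts its whole cell above \<open>\<epsilon>\<close>, and then
  \<open>near\<close> compares each point with this representative in both directions. Without such
  a point all depths in the cell are at most the threshold, so \<open>\<epsilon>\<close> is a valid
  answer even where the depth exceeds \<open>\<epsilon>\<close>.\<close>

lemma ex_answer_table:
  assumes \<epsilon>: "0 < \<epsilon>" "\<epsilon> < 1"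
    and near: "\<And>q q'. \<epsilon> < halfspace_depth K q \<Longrightarrow> f q = f q' \<Longrightarrow>
       (1 - \<epsilon>) * halfspace_depth K q \<le> halfspace_depth K q'"
  shows "\<exists>tab. \<forall>q. valid_depth_answer K \<epsilon> q (tab (f q))"
proof -
  define deep where "deep m q \<longleftrightarrow> f q = m \<and> \<epsilon> / (1 - \<epsilon>) < halfspace_depth K q" for m q
  define tab where "tab m = (if \<exists>q. deep m q then halfspace_depth K (SOME q. deep m q) else \<epsilon>)" for m
  have "valid_depth_answer K \<epsilon> q (tab (f q))" for q
  proof (cases "\<exists>q'. deep (f q) q'")
    case True
    define q' where "q' = (SOME q'. deep (f q) q')"
    have q': "f q' = f q" "\<epsilon> < (1 - \<epsilon>) * halfspace_depth K q'"
      using someI_ex[OF True] \<epsilon> by (auto simp: q'_def deep_def field_simps)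
    have "\<epsilon> \<le> \<epsilon> / (1 - \<epsilon>)" using \<epsilon> by (simp add: field_simps)
    then have "\<epsilon> < halfspace_depth K q'" using someI_ex[OF True] by (simp add: q'_def deep_def)
    then have 1: "(1 - \<epsilon>) * halfspace_depth K q' \<le> halfspace_depth K q" using q' by (intro near) auto
    then have 2: "\<epsilon> < halfspace_depth K q" using q' by simp
    then have "(1 - \<epsilon>) * halfspace_depth K q \<le> halfspace_depth K q'" using q' by (intro near) auto
    then show ?thesis
      using True 1 2 \<epsilon> by (simp add: valid_depth_answer_def tab_def q'_def field_simps)
  next
    case False
    then have "halfspace_depth K q \<le> \<epsilon> / (1 - \<epsilon>)" by (auto simp: deep_def not_less)
    then have "(1 - \<epsilon>) * halfspace_depth K q \<le> \<epsilon>" using \<epsilon> by (simp add: field_simps)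
    moreover have "\<epsilon> \<le> inverse (1 - \<epsilon>) * halfspace_depth K q" if "\<epsilon> < halfspace_depth K q"
      using \<epsilon> that mult_mono[of 1 "inverse (1 - \<epsilon>)" \<epsilon> "halfspace_depth K q"]
      by (simp add: one_le_inverse)
    ultimately show ?thesis using False by (auto simp: valid_depth_answer_def tab_def)
  qed
  then show ?thesis by blast
qed

text \<open>The program depends on \<open>js\<close> alone; \<open>K\<close> and
  \<open>\<epsilon>\<close> enter only through the stored cells, \<open>N\<close> among
  them.\<close>

lemma ex_query_cells:
  fixes K :: "(real ^ 'n) set" and js :: "'n list"
  assumes js: "distinct js" "set js = UNIV"
    and K: "open_convex_body K" and \<epsilon>: "0 < \<epsilon>" "\<epsilon> < 1"
    and N: "5 * (2 ^ (CARD('n) + 2) * CARD('n) ^ 2 / \<epsilon>\<^sup>2) \<le> real N - 1"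
  shows "\<exists>cells. storage_space cells = 8 + CARD('n) * Suc CARD('n) + Suc N ^ CARD('n)
    \<and> answers_depth_queries_within (query_code js) cells K \<epsilon>
        (real (CARD('n) * (4 * N + 3 * CARD('n) + 7) + 3))"
proof -
  define d where "d = CARD('n)"
  have len: "length js = d" using js distinct_card[of js] by (simp add: d_def)
  obtain a :: "'n \<Rightarrow> 'n \<Rightarrow> real" and b :: "'n \<Rightarrow> real" where ab:
    "\<And>q q'. \<epsilon> < halfspace_depth K q \<Longrightarrow>
       (\<And>i. cell_index N ((\<Sum>j\<in>UNIV. a i j * q $ j) + b i)
          = cell_index N ((\<Sum>j\<in>UNIV. a i j * q' $ j) + b i)) \<Longrightarrow>
       (1 - \<epsilon>) * halfspace_depth K q \<le> halfspace_depth K q'"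
    using ex_depth_grid[OF K \<epsilon> N] by blast
  define x where "x q m = (\<Sum>j\<in>UNIV. a (js ! m) j * q $ j) + b (js ! m)" for q :: "real ^ 'n" and m
  define f where "f q = grid_index N (x q) d" for q
  have "\<exists>tab. \<forall>q. valid_depth_answer K \<epsilon> q (tab (f q))"
  proof (rule ex_answer_table[OF \<epsilon>])
    fix q q' assume deep: "\<epsilon> < halfspace_depth K q" and eq: "f q = f q'"
    show "(1 - \<epsilon>) * halfspace_depth K q \<le> halfspace_depth K q'"
    proof (rule ab[OF deep])
      fix i
      obtain m where "m < d" "js ! m = i" using js len by (metis UNIV_I in_set_conv_nth)
      then show "cell_index N ((\<Sum>j\<in>UNIV. a i j * q $ j) + b i)
          = cell_index N ((\<Sum>j\<in>UNIV. a i j * q' $ j) + b i)"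
        using grid_index_eqD[of N "x q" d "x q'" m] eq by (auto simp: f_def x_def)
    qed
  qed
  then obtain tab where tab: "\<And>q. valid_depth_answer K \<epsilon> q (tab (f q))" by blast
  \<comment> \<open>Row-major order with rows of length \<open>d + 1\<close>; the last entry of each
    row is the constant term.\<close>
  define coef where "coef k = (let i = js ! (k div Suc d); c = k mod Suc d in
      if c < d then a i (js ! c) else b i)" for k
  define base where "base = 8 + d * Suc d"
  define hdr where "hdr = [0, 0, 0, 0, 1, real (Suc N), real N, real base]"
  have length_hdr: "length hdr = 8" by (simp add: hdr_def)
  define cells where "cells = hdr @ map coef [0..<d * Suc d] @ map tab [0..<Suc N ^ d]"
  define M where "M = initial_memory cells"
  have length_cells: "length cells = base + Suc N ^ d" by (simp add: cells_def length_hdr base_def)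
  have M_const: "M 0 = 0" "M 4 = 1" "M 5 = real (Suc N)" "M 6 = real N" "M 7 = real base"
    by (simp_all add: M_def initial_memory_def cells_def hdr_def)
  have M_coef: "M (8 + k) = coef k" if k: "k < d * Suc d" for k
  proof -
    have "M (8 + k) = cells ! (length hdr + k)"
      unfolding M_def initial_memory_def length_cells using k by (simp only: length_hdr base_def) simp
    also have "\<dots> = (map coef [0..<d * Suc d] @ map tab [0..<Suc N ^ d]) ! k"
      unfolding cells_def by (rule nth_append_length_plus)
    also have "\<dots> = coef k" using k by (simp only: nth_append) simp
    finally show ?thesis .
  qed
  have M_tab: "M (base + k) = tab k" if k: "k < Suc N ^ d" for k
  proof -
    have "M (base + k) = ((hdr @ map coef [0..<d * Suc d]) @ map tab [0..<Suc N ^ d])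
        ! (length (hdr @ map coef [0..<d * Suc d]) + k)"
      unfolding M_def initial_memory_def length_cells using k
      by (simp only: length_hdr base_def cells_def append_assoc length_append length_map length_upt) simp
    also have "\<dots> = map tab [0..<Suc N ^ d] ! k" by (rule nth_append_length_plus)
    also have "\<dots> = tab k" using k by simp
    finally show ?thesis .
  qed
  have row: "row_val M (8 + m * Suc d) js q = x q m" if m: "m < d" for m q
  proof -
    have lt: "m * Suc d + c < d * Suc d" if "c \<le> d" for c
    proof -
      have "m * Suc d + c < Suc m * Suc d" using that by simp
      also have "\<dots> \<le> d * Suc d" using m by (intro mult_right_mono) auto
      finally show ?thesis .
    qed
    have M_row: "M (8 + m * Suc d + c) = (if c < d then a (js ! m) (js ! c) else b (js ! m))"
      if "c \<le> d" for c
    proof -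
      have "(m * Suc d + c) div Suc d = m" "(m * Suc d + c) mod Suc d = c"
        using that by (simp_all del: mult_Suc_right)
      then show ?thesis
        using M_coef[OF lt[OF that]] by (simp add: coef_def add.assoc del: mult_Suc_right)
    qed
    have "bij_betw ((!) js) {..<d} UNIV"
      using bij_betw_nth[OF js(1), of "{..<d}" UNIV] js(2) len by simp
    then have "(\<Sum>j\<in>UNIV. a (js ! m) j * q $ j) = (\<Sum>c<d. a (js ! m) (js ! c) * q $ (js ! c))"
      by (rule sum.reindex_bij_betw[symmetric])
    also have "\<dots> = (\<Sum>c<d. M (8 + m * Suc d + c) * q $ (js ! c))"
      by (intro sum.cong) (simp_all add: M_row del: mult_Suc_right)
    finally show ?thesis by (simp add: row_val_def x_def len M_row del: mult_Suc_right)
  qed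
  have grid_cong: "grid_index N y n = grid_index N z n" if "\<And>m. m < n \<Longrightarrow> y m = z m" for y z n
    using that by (induction n) auto
  have "answers_depth_queries_within (query_code js) cells K \<epsilon> (real (d * (4 * N + 3 * d + 7) + 3))"
    unfolding answers_depth_queries_within_def
  proof
    fix q :: "real ^ 'n"
    let ?g = "grid_index N (\<lambda>m. row_val M (8 + m * Suc d) js q) d"
    obtain t where t: "runs (query_code js) q 0 M t (M (base + ?g))" "t \<le> d * (4 * N + 3 * d + 7) + 3"
      using query_code_runs[OF M_const, where js = js and q = q] by (auto simp: base_def len)
    have "?g = f q" unfolding f_def using row by (intro grid_cong) auto
    moreover have "f q < Suc N ^ d" unfolding f_def by (rule grid_index_less)
    ultimately have "valid_depth_answer K \<epsilon> q (M (base + ?g))" using tab M_tab by simp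
    then show "\<exists>t out. runs (query_code js) q 0 (initial_memory cells) t out
        \<and> real t \<le> real (d * (4 * N + 3 * d + 7) + 3) \<and> valid_depth_answer K \<epsilon> q out"
      using t unfolding M_def by (meson of_nat_mono)
  qed
  then show ?thesis
    using length_cells unfolding storage_space_def d_def base_def by blast
qed

section \<open>Final bounds on space and time\<close>

lemma answers_depth_queries_within_mono:
  "answers_depth_queries_within P cells K \<epsilon> T \<Longrightarrow> T \<le> T' \<Longrightarrow>
    answers_depth_queries_within P cells K \<epsilon> T'"
  unfolding answers_depth_queries_within_def by (meson order_trans)

theorem theorem1p1:
  shows "\<exists>c > 0. \<exists>P :: ('n::finite) instr list.
    \<forall>(K :: (real ^ 'n) set) (\<epsilon>::real).
      open_convex_body K \<and> 0 < \<epsilon> \<and> \<epsilon> < 1 / 3 \<longrightarrow>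
      (\<exists>cells :: real list.
         real (storage_space cells) \<le> c * \<epsilon> powr (- ((5 * real CARD('n) + 1) / 2))
       \<and> answers_depth_queries_within P cells K \<epsilon> (c * (1 / \<epsilon>^2) * (ln (1 / \<epsilon>))^2))"
proof -
  obtain js :: "'n list" where js: "distinct js" "set js = UNIV"
    using finite_distinct_list[OF finite] by blast
  define d where "d = real CARD('n)"
  \<comment> \<open>\<open>N + 1\<close> will be at most \<open>L + 3\<close>, and
    \<open>1 \<le> 1 / \<epsilon>\<^sup>2\<close> absorbs the 3. The constant \<open>c\<close> is
    the sum of those for space and for time.\<close>
  define C where "C = 5 * (2 ^ (CARD('n) + 2) * d ^ 2) + 3"
  define c where "c = (8 + d * (d + 1) + C ^ CARD('n)) + (d * (4 * C + 3 * d + 7) + 3)"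
  have d: "d > 0" by (simp add: d_def)
  have C: "C > 0" by (auto simp: C_def intro!: add_nonneg_pos)
  have c: "8 + d * (d + 1) + C ^ CARD('n) \<le> c" "d * (4 * C + 3 * d + 7) + 3 \<le> c" "c > 0"
    using d C by (auto simp: c_def intro!: add_pos_pos add_nonneg_nonneg)
  show ?thesis
  proof (rule exI[of _ c], rule conjI[OF c(3)], rule exI[of _ "query_code js"], intro allI impI)
    fix K :: "(real ^ 'n) set" and \<epsilon> :: real
    assume "open_convex_body K \<and> 0 < \<epsilon> \<and> \<epsilon> < 1 / 3"
    then have K: "open_convex_body K" and \<epsilon>: "0 < \<epsilon>" "\<epsilon> < 1 / 3" "\<epsilon> < 1" by auto
    define L where "L = 5 * (2 ^ (CARD('n) + 2) * CARD('n) ^ 2 / \<epsilon>\<^sup>2)"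
    define N where "N = nat \<lceil>L\<rceil> + 1"
    have L: "L \<ge> 0" by (simp add: L_def)
    then have N: "L \<le> real N - 1" "real N \<le> L + 2" unfolding N_def by linarith+
    obtain cells where cells:
      "storage_space cells = 8 + CARD('n) * Suc CARD('n) + Suc N ^ CARD('n)"
      "answers_depth_queries_within (query_code js) cells K \<epsilon>
        (real (CARD('n) * (4 * N + 3 * CARD('n) + 7) + 3))"
      using ex_query_cells[OF js K \<epsilon>(1,3), of N] N by (auto simp: L_def)
    have inv: "1 \<le> 1 / \<epsilon>\<^sup>2" using \<epsilon> by (simp add: power_le_one)
    have NC: "real (Suc N) \<le> C * (1 / \<epsilon>\<^sup>2)"
    proof -
      have "C * (1 / \<epsilon>\<^sup>2) = L + 3 * (1 / \<epsilon>\<^sup>2)"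
        by (simp add: C_def L_def d_def add_divide_distrib distrib_right)
      then show ?thesis using N inv by simp
    qed
    have "real (storage_space cells) = 8 + d * (d + 1) + real (Suc N) ^ CARD('n)"
      by (simp add: cells d_def algebra_simps)
    also have "\<dots> \<le> (8 + d * (d + 1)) * (1 / \<epsilon>\<^sup>2) ^ CARD('n) + (C * (1 / \<epsilon>\<^sup>2)) ^ CARD('n)"
    proof (rule add_mono)
      show "8 + d * (d + 1) \<le> (8 + d * (d + 1)) * (1 / \<epsilon>\<^sup>2) ^ CARD('n)"
        using d mult_left_mono[OF one_le_power[OF inv], of "8 + d * (d + 1)" "CARD('n)"] by simp
      show "real (Suc N) ^ CARD('n) \<le> (C * (1 / \<epsilon>\<^sup>2)) ^ CARD('n)"
        using NC by (intro power_mono) auto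
    qed
    also have "\<dots> = (8 + d * (d + 1) + C ^ CARD('n)) * (1 / \<epsilon>\<^sup>2) ^ CARD('n)"
      by (simp only: power_mult_distrib distrib_right)
    also have "\<dots> \<le> c * (1 / \<epsilon>\<^sup>2) ^ CARD('n)"
      using c by (intro mult_right_mono) auto
    also have "(1 / \<epsilon>\<^sup>2) ^ CARD('n) = \<epsilon> powr (- (2 * d))"
    proof -
      have "(1 / \<epsilon>\<^sup>2) ^ CARD('n) = inverse (\<epsilon> ^ (2 * CARD('n)))"
        by (simp only: power_mult power_one_over inverse_eq_divide)
      also have "\<epsilon> ^ (2 * CARD('n)) = \<epsilon> powr real (2 * CARD('n))"
        by (rule powr_realpow[OF \<epsilon>(1), symmetric])
      also have "real (2 * CARD('n)) = 2 * d" by (simp add: d_def)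
      finally show ?thesis by (simp only: powr_minus)
    qed
    \<comment> \<open>The base is below 1 and \<open>2 * d \<le> (5 * d + 1) / 2\<close>.\<close>
    also have "c * \<epsilon> powr (- (2 * d)) \<le> c * \<epsilon> powr (- ((5 * d + 1) / 2))"
      using \<epsilon> c d by (intro mult_left_mono powr_mono') auto
    finally have space: "real (storage_space cells) \<le> c * \<epsilon> powr (- ((5 * real CARD('n) + 1) / 2))"
      by (simp add: d_def)
    \<comment> \<open>\<open>exp 1 \<le> 3 \<le> 1 / \<epsilon>\<close>, so the logarithmic factor
      of the time bound only enlarges it.\<close>
    have "1 \<le> ln (1 / \<epsilon>)"
    proof -
      have "3 \<le> 1 / \<epsilon>" using \<epsilon> by (simp add: field_simps)
      then have "exp 1 \<le> 1 / \<epsilon>" using exp_le by linarith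
      then show ?thesis using \<epsilon> by (simp add: ln_ge_iff)
    qed
    then have ln: "1 \<le> (ln (1 / \<epsilon>))\<^sup>2" by (simp add: one_le_power)
    have "real (CARD('n) * (4 * N + 3 * CARD('n) + 7) + 3) = d * (4 * real N + 3 * d + 7) + 3"
      by (simp add: d_def)
    also have "\<dots> \<le> d * (4 * (C * (1 / \<epsilon>\<^sup>2)) + (3 * d + 7) * (1 / \<epsilon>\<^sup>2)) + 3 * (1 / \<epsilon>\<^sup>2)"
    proof (rule add_mono[OF mult_left_mono])
      have "3 * d + 7 \<le> (3 * d + 7) * (1 / \<epsilon>\<^sup>2)"
        using d mult_left_mono[OF inv, of "3 * d + 7"] by simp
      then show "4 * real N + 3 * d + 7 \<le> 4 * (C * (1 / \<epsilon>\<^sup>2)) + (3 * d + 7) * (1 / \<epsilon>\<^sup>2)"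
        using NC by linarith
    qed (use inv d in auto)
    also have "\<dots> = (d * (4 * C + 3 * d + 7) + 3) * (1 / \<epsilon>\<^sup>2)" by (simp add: algebra_simps)
    also have "\<dots> \<le> c * (1 / \<epsilon>\<^sup>2)" using c by (intro mult_right_mono) auto
    also have "\<dots> \<le> c * (1 / \<epsilon>\<^sup>2) * (ln (1 / \<epsilon>))\<^sup>2"
      using mult_left_mono[OF ln, of "c * (1 / \<epsilon>\<^sup>2)"] c by simp
    finally have time: "real (CARD('n) * (4 * N + 3 * CARD('n) + 7) + 3)
        \<le> c * (1 / \<epsilon>\<^sup>2) * (ln (1 / \<epsilon>))\<^sup>2" .
    show "\<exists>cells. real (storage_space cells) \<le> c * \<epsilon> powr (- ((5 * real CARD('n) + 1) / 2))
       \<and> answers_depth_queries_within (query_code js) cells K \<epsilon> (c * (1 / \<epsilon>^2) * (ln (1 / \<epsilon>))^2)"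
      using space answers_depth_queries_within_mono[OF cells(2) time] by blast
  qed
qed

end
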